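(* For all integers $m,n\ge 0$, the polynomial $$N_{m,n}(x)=\sum_{k=0}^{m}\left(\binom{m}{k}\binom{n}{k}-\binom{m}{k+1}\binom{n}{k-1}\right)x^k$$ has only real zeros.
   Context: Binomial coefficients $\binom{a}{b}$ with $a$ a nonnegative integer are $0$ when $b<0$ or $b>a$. "Has only real zeros" means that every complex zero is real (nonzero constant polynomials satisfy this vacuously). *)

theory Defs
  imports Complex_Main "HOL-Computational_Algebra.Polynomial"
begin

text \<open>The lower index is an integer: with truncated subtraction on \<^typ>\<open>nat\<close>, the term
  \<open>n choose (k - 1)\<close> would be \<open>1\<close> instead of \<open>0\<close> at \<open>k = 0\<close>.\<close>
definition binom :: "nat \<Rightarrow> int \<Rightarrow> int" where
  "binom a b = (if b < 0 then 0 else int (a choose nat b))"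

definition N_poly :: "nat \<Rightarrow> nat \<Rightarrow> real poly" where
  "N_poly m n = (\<Sum>k\<le>m. monom (real_of_int
     (binom m (int k) * binom n (int k) - binom m (int k + 1) * binom n (int k - 1))) k)"

definition only_real_zeros :: "real poly \<Rightarrow> bool" where
  "only_real_zeros p \<longleftrightarrow> (\<forall>z::complex. poly (map_poly complex_of_real p) z = 0 \<longrightarrow> z \<in> \<real>)"

end

theory Submission
  imports Defs "HOL-Computational_Algebra.Fundamental_Theorem_Algebra"
begin

text \<open>Since
  \<open>(m+1) (n+1) N\<^sub>k = C(m+1, k+1) C(n+1, k) ((n+1) + k (n - m))\<close> for the coefficients \<open>N\<^sub>k\<close>, the
  polynomial is, up to a positive factor, \<open>(n+1) f + (n - m) x f'\<close> with
  \<open>f = \<Sum> C(m+1, k+1) C(n+1, k) x\<^sup>k\<close>. By Vandermonde, \<open>f(z)\<close> is the coefficient of \<open>t\<^sup>m\<close> in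
  \<open>(1 + t)\<^bsup>m+1\<^esup> (1 + z t)\<^bsup>n+1\<^esup>\<close>. If \<open>z\<close> is not a nonpositive real, the zeros \<open>-1\<close> and \<open>-1/z\<close> lie in
  an open half-plane whose boundary contains \<open>0\<close>, so by Gauss--Lucas the \<open>m\<close>-th derivative in \<open>t\<close>
  does not vanish at \<open>0\<close>. Hence all zeros of \<open>f\<close> are negative reals \<open>r\<close>. Finally, for nonreal \<open>z\<close>
  the number \<open>z f'(z) / f(z) = \<Sum> z / (z - r)\<close> has imaginary part of the sign of \<open>Im z\<close>, so it
  cannot equal a real number.\<close>

text \<open>Splitting off one root at a time writes \<open>u * p'(z) / p(z)\<close> as the sum of
  \<open>u / (z - r)\<close> over the roots with multiplicity. The factor \<open>u\<close> serves to
  rotate the half-plane: once for Gauss--Lucas, once for the final argument on imaginary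
  parts.\<close>

lemma Re_logderiv_pos:
  fixes p :: "complex poly"
  assumes "degree p > 0" and "poly p z \<noteq> 0"
    and roots: "\<And>r. poly p r = 0 \<Longrightarrow> Re (u / (z - r)) > 0"
  shows "Re (u * poly (pderiv p) z / poly p z) > 0"
  using assms
proof (induction "degree p" arbitrary: p rule: less_induct)
  case less
  obtain r where r: "poly p r = 0"
    using fundamental_theorem_of_algebra[of p] less.prems(1)
    by (auto simp: constant_degree)
  then obtain q where p: "p = [:-r, 1:] * q"
    by (auto simp: poly_eq_0_iff_dvd)
  have q0: "q \<noteq> 0" and zr: "z - r \<noteq> 0" and qz: "poly q z \<noteq> 0"
    using less.prems(1,2) unfolding p by auto
  have deg: "degree p = Suc (degree q)"
    unfolding p using q0 by (subst degree_mult_eq) auto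
  have pr: "Re (u / (z - r)) > 0" by (rule less.prems(3)[OF r])
  have split: "u * poly (pderiv p) z / poly p z
      = u / (z - r) + u * poly (pderiv q) z / poly q z"
  proof -
    have "poly p z = (z - r) * poly q z"
      "poly (pderiv p) z = poly q z + (z - r) * poly (pderiv q) z"
      unfolding p pderiv_mult by (simp_all add: pderiv_pCons algebra_simps)
    then show ?thesis using zr qz by (simp add: add_divide_distrib distrib_left)
  qed
  show ?case
  proof (cases "degree q = 0")
    case True
    then have "pderiv q = 0" by (simp add: pderiv_eq_0_iff)
    then show ?thesis using split pr by simp
  next
    case False
    have "Re (u * poly (pderiv q) z / poly q z) > 0"
      by (rule less.hyps) (use False deg qz less.prems(3) p in auto)
    then show ?thesis using split pr by simp
  qed
qed

lemma Gauss_Lucas_half_plane: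
  fixes p :: "complex poly"
  assumes "degree p > 0" and roots: "\<And>r. poly p r = 0 \<Longrightarrow> Re (w * r) < 0"
    and "poly (pderiv p) z = 0"
  shows "Re (w * z) < 0"
proof (rule ccontr)
  assume neg: "\<not> ?thesis"
  then have "poly p z \<noteq> 0" using roots by blast
  moreover have "Re (inverse w / (z - r)) > 0" if "poly p r = 0" for r
  proof -
    have pos: "Re (w * z - w * r) > 0" using neg roots[OF that] by simp
    have "inverse w / (z - r) = inverse (w * z - w * r)"
      by (simp add: divide_inverse flip: right_diff_distrib)
    moreover have "Re (inverse c) > 0" if "Re c > 0" for c
      using that by (auto simp: divide_pos_pos add_pos_nonneg)
    ultimately show ?thesis using pos by metis
  qed
  ultimately have "Re (inverse w * poly (pderiv p) z / poly p z) > 0"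
    using assms(1) by (intro Re_logderiv_pos)
  then show False using assms(3) by simp
qed

text \<open>The bound on \<open>j\<close> ensures that every polynomial differentiated on the way
  still has positive degree, so Gauss--Lucas applies at each step.\<close>

lemma Gauss_Lucas_half_plane_higher:
  fixes p :: "complex poly"
  assumes "p \<noteq> 0" and roots: "\<And>r. poly p r = 0 \<Longrightarrow> Re (w * r) < 0"
    and "j \<le> degree p" and "poly ((pderiv ^^ j) p) z = 0"
  shows "Re (w * z) < 0"
  using assms(3,4)
proof (induction j arbitrary: z)
  case 0
  then show ?case using roots by simp
next
  case (Suc j)
  show ?case
    by (rule Gauss_Lucas_half_plane[of "(pderiv ^^ j) p"])
       (use Suc in \<open>auto simp: degree_higher_pderiv\<close>)
qed

lemma coeff_one_plus_power:
  fixes c :: "'a :: comm_ring_1"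
  shows "coeff ([:1, c:] ^ n) i = of_nat (n choose i) * c ^ i"
proof (cases "i \<le> n")
  case True
  then show ?thesis by (simp add: coeff_linear_poly_power)
next
  case False
  have "degree ([:1, c:] ^ n) \<le> degree [:1, c:] * n" by (rule degree_power_le)
  also have "\<dots> \<le> 1 * n" by (intro mult_right_mono) auto
  finally show ?thesis using False by (simp add: coeff_eq_0 binomial_eq_0)
qed

lemma Vandermonde_poly_zeros_negative:
  fixes z :: complex
  assumes "j \<le> M"
    and zero: "(\<Sum>k\<le>j. of_nat (M choose (j - k)) * of_nat (N choose k) * z ^ k) = 0"
  shows "Im z = 0" and "Re z < 0"
proof -
  have "Im z = 0 \<and> Re z < 0"
  proof (rule ccontr)
    assume neg: "\<not> ?thesis"
    have z0: "z \<noteq> 0"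
    proof
      assume "z = 0"
      then have "(\<Sum>k\<le>j. of_nat (M choose (j - k)) * of_nat (N choose k) * z ^ k)
          = (of_nat (M choose j) :: complex)"
        by (simp add: power_0_left if_distrib[of "\<lambda>x. _ * x"] cong: if_cong)
      then show False using zero \<open>j \<le> M\<close> by simp
    qed
    have pos: "cmod z + Re z > 0"
    proof -
      have "cmod z \<noteq> - Re z"
      proof
        assume *: "cmod z = - Re z"
        then have "(Re z)\<^sup>2 + (Im z)\<^sup>2 = (Re z)\<^sup>2"
          by (metis cmod_power2 power2_minus)
        then have "Im z = 0" by simp
        moreover have "Re z < 0" using * z0 by (smt (verit) zero_less_norm_iff)
        ultimately show False using neg by blast
      qed
      then show ?thesis using abs_Re_le_cmod[of z] by linarith
    qed
    \<comment> \<open>The conjugate of \<open>w\<close> is \<open>cmod z\<close> times the sum of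
      the unit vectors towards 1 and 1/z, so it bisects their angle. Both roots -1 and -1/z thus
      satisfy \<open>Re (w * r) < 0\<close>, as these unit vectors are not opposite by
      \<open>pos\<close>.\<close>
    define w where "w = of_real (cmod z) + z"
    define p where "p = [:1, z:] ^ N * [:1, 1:] ^ M"
    have p0: "p \<noteq> 0" by (simp add: p_def)
    have "degree p = N + M"
      using z0 by (simp add: p_def degree_mult_eq degree_power_eq)
    then have deg: "j \<le> degree p" using \<open>j \<le> M\<close> by simp
    have roots: "Re (w * r) < 0" if "poly p r = 0" for r
    proof -
      from that have "1 + r * z = 0 \<or> 1 + r = 0" by (auto simp: p_def)
      then consider "r = - (1 / z)" | "r = -1"
        using z0 by (auto simp: field_simps eq_neg_iff_add_eq_0 add.commute)
      then show ?thesis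
      proof cases
        case 1
        have "w * r = - (of_real (cmod z) / z + 1)"
          using z0 by (simp add: 1 w_def field_simps)
        also have "of_real (cmod z) / z = cnj z / of_real (cmod z)"
          using z0 complex_norm_square[of z] by (simp add: field_simps power2_eq_square)
        finally have "Re (w * r) = - (Re z / cmod z + 1)"
          by (simp only: uminus_complex.simps plus_complex.simps Re_divide_of_real
              complex_cnj one_complex.simps cnj.simps)
        also have "\<dots> = - ((cmod z + Re z) / cmod z)"
          using z0 by (simp add: add_divide_distrib)
        also have "\<dots> < 0" using pos z0 by (simp add: divide_pos_pos)
        finally show ?thesis .
      next
        case 2
        then show ?thesis using pos by (simp add: w_def)
      qed
    qed
    have "coeff p j = 0"
      using zero unfolding p_def coeff_mult coeff_one_plus_power by (simp add: mult_ac)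
    then have "poly ((pderiv ^^ j) p) 0 = 0"
      by (simp add: poly_0_coeff_0 coeff_higher_pderiv)
    \<comment> \<open>The point 0 lies on the boundary of the open half-plane, not inside
      it.\<close>
    from Gauss_Lucas_half_plane_higher[OF p0 roots deg this] show False by simp
  qed
  then show "Im z = 0" "Re z < 0" by auto
qed

lemma real_zero_Euler_operator:
  fixes p :: "complex poly" and a b :: real
  assumes "p \<noteq> 0" and "a \<noteq> 0"
    and roots: "\<And>r. poly p r = 0 \<Longrightarrow> Im r = 0 \<and> Re r < 0"
    and zero: "of_real a * poly p z + of_real b * (z * poly (pderiv p) z) = 0"
  shows "z \<in> \<real>"
proof (rule ccontr)
  assume "z \<notin> \<real>"
  then have im: "Im z \<noteq> 0" by (simp add: complex_is_Real_iff)
  then have pz: "poly p z \<noteq> 0" using roots by blast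
  \<comment> \<open>Otherwise \<open>zero\<close> would collapse to
    \<open>a * p(z) = 0\<close>.\<close>
  have b0: "b \<noteq> 0" and p': "poly (pderiv p) z \<noteq> 0"
    using zero pz \<open>a \<noteq> 0\<close> by auto
  then have "degree p > 0" by (metis pderiv_eq_0_iff gr0I poly_0)
  \<comment> \<open>With this \<open>u\<close>, \<open>Re (u * v) = Im z * Im (z * v)\<close> for
    every \<open>v\<close>, so a positive real part says that \<open>Im (z * v)\<close> has the sign
    of \<open>Im z\<close>.\<close>
  define u where "u = - \<i> * of_real (Im z) * z"
  have "Re (u * poly (pderiv p) z / poly p z) > 0"
  proof (rule Re_logderiv_pos[OF \<open>degree p > 0\<close> pz])
    fix r assume "poly p r = 0"
    then have r: "Im r = 0" "Re r < 0" using roots by auto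
    have "z \<noteq> r" using im r by auto
    then have n: "(Re z - Re r)\<^sup>2 + (Im z)\<^sup>2 > 0"
      using im by (simp add: add_nonneg_pos)
    have "Re (u / (z - r)) = (Im z)\<^sup>2 * (- Re r) / ((Re z - Re r)\<^sup>2 + (Im z)\<^sup>2)"
      using r by (simp add: u_def Re_divide power2_eq_square algebra_simps)
    also have "\<dots> > 0" using im r n by (intro divide_pos_pos mult_pos_pos) auto
    finally show "Re (u / (z - r)) > 0" .
  qed
  moreover have "z * poly (pderiv p) z / poly p z = of_real (- a / b)"
    using zero pz b0 by (simp add: field_simps eq_neg_iff_add_eq_0)
  then have "u * poly (pderiv p) z / poly p z = - \<i> * of_real (Im z) * of_real (- a / b)"
    unfolding u_def by (metis mult.assoc times_divide_eq_right)
  ultimately show False by simp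
qed

lemma real_Suc_times_binomial_Suc:
  "(real k + 1) * real (n choose Suc k) = (real n - real k) * real (n choose k)"
proof (cases "k \<le> n")
  case True
  have "Suc k * (n choose Suc k) = (n - k) * (n choose k)"
    using binomial_absorption[of k n] binomial_absorb_comp[of n k] by simp
  then have "real (Suc k * (n choose Suc k)) = real ((n - k) * (n choose k))" by simp
  then show ?thesis using True by (simp add: of_nat_diff algebra_simps)
next
  case False
  then show ?thesis by (simp add: binomial_eq_0)
qed

text \<open>The last factor is affine in \<open>k\<close>, which is what turns the coefficient
  identity into a combination of \<open>f\<close> and \<open>x f'\<close>.\<close>

lemma N_poly_coeff_factorization:
  "(real m + 1) * (real n + 1) * real_of_int
     (binom m (int k) * binom n (int k) - binom m (int k + 1) * binom n (int k - 1))
   = real (Suc m choose Suc k) * real (Suc n choose k) * (real n + 1 + real k * (real n - real m))"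
proof (cases k)
  case 0
  then show ?thesis by (simp add: binom_def)
next
  case (Suc j)
  \<comment> \<open>All other binomials are rational multiples of \<open>A\<close> and
    \<open>B\<close> with denominators \<open>j + 1\<close> and \<open>j + 2\<close>. These never
    vanish, so \<open>k\<close> need not be compared with \<open>m\<close> or
    \<open>n\<close>.\<close>
  define A B where "A = real (m choose Suc j)" and "B = real (n choose j)"
  have A': "real (m choose Suc (Suc j)) = (real m - real j - 1) * A / (real j + 2)"
    using real_Suc_times_binomial_Suc[of "Suc j" m] by (simp add: A_def field_simps)
  have B': "real (n choose Suc j) = (real n - real j) * B / (real j + 1)"
    using real_Suc_times_binomial_Suc[of j n] by (simp add: B_def field_simps)
  have nats: "nat (1 + int j) = Suc j" "nat (2 + int j) = Suc (Suc j)" by auto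
  have "real_of_int
     (binom m (int k) * binom n (int k) - binom m (int k + 1) * binom n (int k - 1))
     = A * real (n choose Suc j) - real (m choose Suc (Suc j)) * B"
    by (simp add: Suc binom_def A_def B_def nats del: binomial_Suc_Suc)
  moreover have "real (Suc m choose Suc k) = A + real (m choose Suc (Suc j))"
    "real (Suc n choose k) = B + real (n choose Suc j)"
    by (simp_all add: Suc A_def B_def)
  moreover have "(real m + 1) * (real n + 1) * (A * B' - A' * B)
      = (A + A') * (B + B') * (real n + 1 + (real j + 1) * (real n - real m))"
    if "B' = (real n - real j) * B / (real j + 1)"
      and "A' = (real m - real j - 1) * A / (real j + 2)" for A' B'
  proof -
    have "A + A' = (real m + 1) * A / (real j + 2)" "B + B' = (real n + 1) * B / (real j + 1)"
      unfolding that by (simp_all add: field_simps)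
    moreover have "A * B' - A' * B = A * B * (real n + 1 + (real j + 1) * (real n - real m))
        / ((real j + 2) * (real j + 1))"
      unfolding that by (simp add: divide_simps) (simp add: algebra_simps)
    ultimately show ?thesis by simp
  qed
  note this[OF B' A']
  moreover have "real k = real j + 1" by (simp add: Suc)
  ultimately show ?thesis by (simp only:)
qed

theorem corollary4p5:
  fixes m n :: nat
  shows "only_real_zeros (N_poly m n)"
  unfolding only_real_zeros_def
proof (intro allI impI)
  fix z :: complex
  assume zero: "poly (map_poly complex_of_real (N_poly m n)) z = 0"
  define c where "c k = real_of_int
     (binom m (int k) * binom n (int k) - binom m (int k + 1) * binom n (int k - 1))" for k
  define d where "d k = real (Suc m choose Suc k) * real (Suc n choose k)" for k
  define f where "f = (\<Sum>k\<le>m. monom (complex_of_real (d k)) k)"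
  have "map_poly complex_of_real (N_poly m n) = (\<Sum>k\<le>m. monom (complex_of_real (c k)) k)"
    by (rule poly_eqI) (simp add: coeff_map_poly N_poly_def c_def coeff_sum if_distrib)
  then have c0: "(\<Sum>k\<le>m. complex_of_real (c k) * z ^ k) = 0"
    using zero by (simp add: poly_sum poly_monom)
  have fx: "poly f x = (\<Sum>k\<le>m. of_real (d k) * x ^ k)" for x
    by (simp add: f_def poly_sum poly_monom)
  have f': "z * poly (pderiv f) z = (\<Sum>k\<le>m. of_real (real k * d k) * z ^ k)"
    unfolding f_def higher_pderiv_sum[of 1, simplified] poly_sum sum_distrib_left
  proof (rule sum.cong)
    show "z * poly (pderiv (monom (of_real (d k)) k)) z = of_real (real k * d k) * z ^ k" for k
      \<comment> \<open>For \<open>k = 0\<close> the truncated exponent \<open>k - 1\<close> is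
        harmless, since both sides vanish.\<close>
      by (cases k) (simp_all add: pderiv_monom poly_monom)
  qed simp
  have "coeff f 0 = of_real (d 0)"
    by (simp add: f_def coeff_sum)
  moreover have "d 0 = real (Suc m)" by (simp add: d_def)
  ultimately have "f \<noteq> 0" by (metis coeff_0 of_real_eq_0_iff of_nat_eq_0_iff nat.distinct(2))
  show "z \<in> \<real>"
  proof (rule real_zero_Euler_operator[OF \<open>f \<noteq> 0\<close>])
    show "Im r = 0 \<and> Re r < 0" if "poly f r = 0" for r
    proof -
      \<comment> \<open>Reflecting the first binomial makes the lower indices add up to
        \<open>m\<close>, the Vandermonde form with \<open>j = m\<close>, \<open>M = m + 1\<close>,
        \<open>N = n + 1\<close>.\<close>
      have "d k = real (Suc m choose (m - k)) * real (Suc n choose k)" if "k \<le> m" for k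
        using binomial_symmetric[of "Suc k" "Suc m"] that by (simp add: d_def)
      then have "(\<Sum>k\<le>m. of_nat (Suc m choose (m - k)) * of_nat (Suc n choose k) * r ^ k) = 0"
        using \<open>poly f r = 0\<close> unfolding fx by simp
      from Vandermonde_poly_zeros_negative[OF _ this] show ?thesis by simp
    qed
    have "of_real (real n + 1) * poly f z + of_real (real n - real m) * (z * poly (pderiv f) z)
        = (\<Sum>k\<le>m. of_real (d k * (real n + 1 + real k * (real n - real m))) * z ^ k)"
      unfolding fx f' sum_distrib_left sum.distrib[symmetric]
      by (intro sum.cong) (simp_all add: algebra_simps)
    also have "\<dots> = of_real ((real m + 1) * (real n + 1)) * (\<Sum>k\<le>m. of_real (c k) * z ^ k)"
      unfolding d_def c_def N_poly_coeff_factorization[symmetric] sum_distrib_left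
      by (simp add: mult.assoc)
    finally show "of_real (real n + 1) * poly f z
        + of_real (real n - real m) * (z * poly (pderiv f) z) = 0"
      using c0 by simp
  qed simp
qed

end
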